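(* Suppose $\Omega=(\Omega(k))_{k\in 2\mathbb{Z}}$ is an almost submultiplicative weight. Let $v\in W_\infty(\Omega)$, and let $(V(k))_{k\in 2\mathbb{Z}}$ be its Fourier coefficients. (a) If $\Delta\subset\mathbb{N}$ is an infinite set such that $$|V(\pm 2n)|\,\frac{n}{\log n}\,\Omega(2n)\to\infty\quad\text{as } n\in\Delta,\ n\to\infty,$$ then $$\beta_n^\pm(v,z)\sim V(\pm 2n)\quad\text{for } |z|\le n/2,\ n\in\Delta,\ n\to\infty. \qquad ( * )$$ (b) If $\lim_{|k|\to\infty}|V(k)|\,\Omega(k)=0$ and $\Delta\subset\mathbb{N}$ is an infinite set such that $$\exists\, c>0:\quad |V(\pm 2n)|\,\frac{n}{\log n}\,\Omega(2n)\ge c\quad\text{for } n\in\Delta,$$ then $( * )$ holds.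
   Context: Weights. A weight is a sequence of positive numbers $\Omega=(\Omega(k))_{k\in 2\mathbb{Z}}$ with $\Omega(-k)=\Omega(k)$, $\Omega(0)=1$, and $\Omega(k)\le\Omega(m)$ for $m\ge k\ge 0$. A weight $\Omega$ is almost submultiplicative if there is a constant $C>0$ with $\Omega(k+m)\le C\,\Omega(k)\Omega(m)$ for all $k,m\in 2\mathbb{Z}$. Weighted space. $W_\infty(\Omega)$ is the space of all (possibly distributional, $\pi$-periodic, complex) potentials $v(x)=\sum_{k\in 2\mathbb{Z}}V(k)e^{ikx}$ with $\|v\|_\Omega=\sup_{k\in 2\mathbb{Z}}|V(k)|\,\Omega(k)<\infty$; the $V(k)$ are the Fourier coefficients of $v$. Functionals $\beta_n^\pm$. For sufficiently large $n\in\mathbb{N}$ and $|z|<n$, $$\beta_n^-(v,z)=V(-2n)+\sum_{k=1}^\infty S_k^{12}(n,z),\qquad \beta_n^+(v,z)=V(2n)+\sum_{k=1}^\infty S_k^{21}(n,z),$$ where, all sums being over $j_1,\dots,j_k\in (n+2\mathbb{Z})\setminus\{\pm n\}$, $$S_k^{12}(n,z)=\sum_{j_1,\dots,j_k}\frac{V(-n-j_1)V(j_1-j_2)\cdots V(j_{k-1}-j_k)V(j_k-n)}{(n^2-j_1^2+z)\cdots(n^2-j_k^2+z)},$$ $$S_k^{21}(n,z)=\sum_{j_1,\dots,j_k}\frac{V(n-j_1)V(j_1-j_2)\cdots V(j_{k-1}-j_k)V(j_k+n)}{(n^2-j_1^2+z)\cdots(n^2-j_k^2+z)}.$$ Conventions.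 $a_n\sim b_n$ means $a_n/b_n\to 1$; here $\beta_n^\pm(v,z)\sim V(\pm 2n)$ for $|z|\le n/2$ means $\sup_{|z|\le n/2}|\beta_n^\pm(v,z)/V(\pm 2n)-1|\to 0$ as $n\to\infty$, $n\in\Delta$. Hypotheses and conclusions with $\pm$ are asserted for both signs. *)

theory Defs
  imports "HOL-Analysis.Analysis"
begin

(* Weights and Fourier coefficients are indexed by 2Z.  They are represented as functions
   on int of which only the values at even arguments are ever used. *)

definition weight :: "(int \<Rightarrow> real) \<Rightarrow> bool" where
  "weight \<Omega> \<longleftrightarrow>
     (\<forall>k. even k \<longrightarrow> \<Omega> k > 0) \<and>
     (\<forall>k. even k \<longrightarrow> \<Omega> (- k) = \<Omega> k) \<and>
     \<Omega> 0 = 1 \<and>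
     (\<forall>k m. even k \<longrightarrow> even m \<longrightarrow> 0 \<le> k \<longrightarrow> k \<le> m \<longrightarrow> \<Omega> k \<le> \<Omega> m)"

definition almost_submultiplicative :: "(int \<Rightarrow> real) \<Rightarrow> bool" where
  "almost_submultiplicative \<Omega> \<longleftrightarrow>
     (\<exists>C>0. \<forall>k m. even k \<longrightarrow> even m \<longrightarrow> \<Omega> (k + m) \<le> C * \<Omega> k * \<Omega> m)"

(* Potentials are pi-periodic complex distributions: continuous linear functionals on the
   Frechet space of smooth pi-periodic functions.  A functional is a total function in HOL;
   its values outside the space of test functions are irrelevant. *)

definition iter_deriv :: "nat \<Rightarrow> (real \<Rightarrow> complex) \<Rightarrow> real \<Rightarrow> complex" where
  "iter_deriv m \<phi> = ((\<lambda>f x. vector_derivative f (at x)) ^^ m) \<phi>"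

definition test_functions :: "(real \<Rightarrow> complex) set" where
  "test_functions =
     {\<phi>. (\<forall>x. \<phi> (x + pi) = \<phi> x) \<and> (\<forall>m x. iter_deriv m \<phi> differentiable at x)}"

definition periodic_distribution :: "((real \<Rightarrow> complex) \<Rightarrow> complex) \<Rightarrow> bool" where
  "periodic_distribution v \<longleftrightarrow>
     (\<forall>\<phi>\<in>test_functions. \<forall>\<psi>\<in>test_functions. v (\<lambda>x. \<phi> x + \<psi> x) = v \<phi> + v \<psi>) \<and>
     (\<forall>c. \<forall>\<phi>\<in>test_functions. v (\<lambda>x. c * \<phi> x) = c * v \<phi>) \<and>
     (\<exists>C N. \<forall>\<phi>\<in>test_functions.
        norm (v \<phi>) \<le> C * (\<Sum>m\<le>N. SUP x\<in>{0..pi}. norm (iter_deriv m \<phi> x)))"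

(* Normalisation: a locally integrable pi-periodic f acts on a test function by the
   integral of their product over [0, pi], so that v = sum of V(k) exp(ikx). *)

definition fourier_coeff :: "((real \<Rightarrow> complex) \<Rightarrow> complex) \<Rightarrow> int \<Rightarrow> complex" where
  "fourier_coeff v k = v (\<lambda>x. exp (- (\<i> * of_int k * of_real x))) / of_real pi"

definition weighted_norm :: "(int \<Rightarrow> real) \<Rightarrow> ((real \<Rightarrow> complex) \<Rightarrow> complex) \<Rightarrow> ereal" where
  "weighted_norm \<Omega> v = (SUP k\<in>{k. even k}. ereal (norm (fourier_coeff v k) * \<Omega> k))"

definition W_infty :: "(int \<Rightarrow> real) \<Rightarrow> ((real \<Rightarrow> complex) \<Rightarrow> complex) set" where
  "W_infty \<Omega> = {v. periodic_distribution v \<and> weighted_norm \<Omega> v < \<infinity>}"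

definition J :: "nat \<Rightarrow> int set" where
  "J n = {int n + 2 * m | m. True} - {int n, - int n}"

(* The sums S_k^12 and S_k^21 for k >= 1; the tuple (j_1, ..., j_k) is the function j. *)

definition S12 :: "(int \<Rightarrow> complex) \<Rightarrow> nat \<Rightarrow> nat \<Rightarrow> complex \<Rightarrow> complex" where
  "S12 V k n z = (\<Sum>\<^sub>\<infinity> j \<in> {1..k} \<rightarrow>\<^sub>E J n.
     V (- int n - j 1) * (\<Prod>i=1..<k. V (j i - j (i + 1))) * V (j k - int n)
       / (\<Prod>i=1..k. of_int ((int n)\<^sup>2 - (j i)\<^sup>2) + z))"

definition S21 :: "(int \<Rightarrow> complex) \<Rightarrow> nat \<Rightarrow> nat \<Rightarrow> complex \<Rightarrow> complex" where
  "S21 V k n z = (\<Sum>\<^sub>\<infinity> j \<in> {1..k} \<rightarrow>\<^sub>E J n.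
     V (int n - j 1) * (\<Prod>i=1..<k. V (j i - j (i + 1))) * V (j k + int n)
       / (\<Prod>i=1..k. of_int ((int n)\<^sup>2 - (j i)\<^sup>2) + z))"

(* For bounded V, which includes every v in W_infty of a weight, all series below converge
   absolutely when n is large and |z| < n. *)

definition beta_minus :: "((real \<Rightarrow> complex) \<Rightarrow> complex) \<Rightarrow> nat \<Rightarrow> complex \<Rightarrow> complex" where
  "beta_minus v n z =
     fourier_coeff v (- 2 * int n) + (\<Sum>k. S12 (fourier_coeff v) (Suc k) n z)"

definition beta_plus :: "((real \<Rightarrow> complex) \<Rightarrow> complex) \<Rightarrow> nat \<Rightarrow> complex \<Rightarrow> complex" where
  "beta_plus v n z =
     fourier_coeff v (2 * int n) + (\<Sum>k. S21 (fourier_coeff v) (Suc k) n z)"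

definition to_infinity_in :: "nat set \<Rightarrow> nat filter" where
  "to_infinity_in \<Delta> = inf at_top (principal \<Delta>)"

(* The supremum is taken in ereal, so that an unbounded quotient counts as infinity. *)

definition sim_on_discs :: "(nat \<Rightarrow> complex \<Rightarrow> complex) \<Rightarrow> (nat \<Rightarrow> complex) \<Rightarrow> nat set \<Rightarrow> bool" where
  "sim_on_discs \<beta> a \<Delta> \<longleftrightarrow>
     ((\<lambda>n. SUP z\<in>{z. norm z \<le> real n / 2}. ereal (norm (\<beta> n z / a n - 1))) \<longlongrightarrow> 0)
       (to_infinity_in \<Delta>)"

end

theory Submission
  imports Defs
begin

text \<open>
  Every term of \<open>S\<^sub>k\<close> has a numerator \<open>V(-a - j\<^sub>1) V(j\<^sub>1 - j\<^sub>2) \<dots> V(j\<^sub>k - a)\<close> with \<open>a = n\<close> for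
  \<open>\<beta>\<^sub>n\<^sup>-\<close> and \<open>a = -n\<close> for \<open>\<beta>\<^sub>n\<^sup>+\<close>. Its arguments add up to \<open>-2a\<close>, so \<open>k\<close> applications of almost
  submultiplicativity give \<open>\<Omega>(2n) \<le> C\<^sup>k \<Omega>(-a - j\<^sub>1) \<dots> \<Omega>(j\<^sub>k - a)\<close>
  (\<open>almost_submultiplicative_chain\<close>). If \<open>|V| \<Omega> \<le> M\<close>, the numerator is therefore at most
  \<open>C\<^sup>k M\<^sup>k\<^sup>+\<^sup>1 / \<Omega>(2n)\<close>, uniformly in the indices \<open>j\<close>.

  What remains is the sum of the reciprocal denominators, which factorises into \<open>k\<close> copies of
  \<open>\<Sum>\<^sub>j 1 / |n\<^sup>2 - j\<^sup>2 + z|\<close>. For \<open>|z| \<le> n/2\<close> the shift by \<open>z\<close> at most halves the denominators, and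
  partial fractions bound the unshifted sum by \<open>H\<^sub>n / n\<close> with the harmonic number \<open>H\<^sub>n\<close>
  (\<open>sum_resonance_denominators_le\<close>). So each copy is at most \<open>t = 4 ln n / n\<close>, and
  \<open>|S\<^sub>k| \<Omega>(2n) \<le> M (C M t)\<^sup>k\<close> (\<open>norm_chain_sum_le\<close>).

  The term \<open>S\<^sub>1\<close> admits a better bound. Of its two factors \<open>V(-a - j)\<close> and \<open>V(j - a)\<close> one has an
  argument of modulus at least \<open>n\<close>, so one factor \<open>M\<close> improves to \<open>\<epsilon>\<^sub>n\<close>, a bound for \<open>|V(k)| \<Omega>(k)\<close> over
  \<open>|k| \<ge> n\<close>. Once \<open>C M t \<le> 1/2\<close>, the geometric series over \<open>k \<ge> 2\<close> gives (\<open>norm_chain_series_le\<close>)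
  \<open>|\<beta>\<^sub>n - V(-2a)| \<Omega>(2n) \<le> t (C M \<epsilon>\<^sub>n + 2 C\<^sup>2 M\<^sup>3 t)\<close>.
  Dividing by \<open>|V(-2a)| \<Omega>(2n)\<close> leaves, up to the factor 4, the quotient of the bracket by
  \<open>r\<^sub>n = |V(-2a)| (n / ln n) \<Omega>(2n)\<close>. In part (a) the bracket is bounded and \<open>r\<^sub>n \<rightarrow> \<infinity>\<close>; in part (b)
  the bracket tends to 0 and \<open>r\<^sub>n\<close> is bounded below.
\<close>

section \<open>Resonance denominators\<close>

lemma sum_inverse_shifted_products_le_harm:
  assumes "n > 0"
  shows "(\<Sum>p=1..N. 1 / (real p * real (p + n))) \<le> harm n / real n"
proof -
  have "(\<Sum>p=1..N. 1 / (real p * real (p + n)))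
      = (\<Sum>p=1..N. inverse (real p) - inverse (real (p + n))) / real n"
    unfolding sum_divide_distrib
  proof (rule sum.cong)
    fix p assume "p \<in> {1..N}"
    then have "inverse (real p) - inverse (real (p + n)) = real n / (real p * real (p + n))"
      by (simp add: divide_simps)
    then show "1 / (real p * real (p + n)) = (inverse (real p) - inverse (real (p + n))) / real n"
      using assms by simp
  qed simp
  also have "(\<Sum>p=1..N. inverse (real p) - inverse (real (p + n))) = harm N - (harm (N + n) - harm n)"
    by (induction N) (simp_all add: harm_Suc harm_def)
  also have "\<dots> \<le> harm n"
    using harm_mono[of N "N + n", where 'a = real] by simp
  finally show ?thesis
    by (simp add: divide_right_mono)
qed

lemma sum_inverse_complementary_products_le_harm:
  "(\<Sum>p=1..<n. 1 / (real p * real (n - p))) \<le> 2 * harm n / real n"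
proof (cases "n = 0")
  case False
  have "(\<Sum>p=1..<n. 1 / (real p * real (n - p)))
      = (\<Sum>p=1..<n. inverse (real p) + inverse (real (n - p))) / real n"
    unfolding sum_divide_distrib
    by (rule sum.cong) (use False in \<open>auto simp: field_simps\<close>)
  also have "(\<Sum>p=1..<n. inverse (real p) + inverse (real (n - p))) = 2 * (\<Sum>p=1..<n. inverse (real p))"
    using sum.nat_diff_reindex[of "\<lambda>p. inverse (real (Suc p))" "n - 1"]
    by (subst sum.distrib, subst sum.reindex_bij_witness[where i = "\<lambda>p. n - p" and j = "\<lambda>p. n - p" 
          and h = "\<lambda>p. inverse (real p)" and T = "{1..<n}"]) auto
  also have "\<dots> \<le> 2 * harm n"
    unfolding harm_def by (intro mult_left_mono sum_mono2) auto
  finally show ?thesis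
    by (simp add: divide_right_mono)
qed simp

text \<open>
  With \<open>j = n + 2m\<close> the denominator is \<open>-4m(m + n)\<close>, whose zeros \<open>0\<close> and \<open>-n\<close> cut the integers into
  three ranges. Partial fractions bound the two outer ranges by \<open>H\<^sub>n / 4n\<close> each and the middle one by
  twice as much.
\<close>

lemma sum_resonance_denominators_le:
  assumes "finite F" "F \<subseteq> J n" "n > 0"
  shows "(\<Sum>j\<in>F. 1 / \<bar>real_of_int ((int n)\<^sup>2 - j\<^sup>2)\<bar>) \<le> harm n / real n"
proof -
  define M where "M = {m. int n + 2 * m \<in> F}"
  define g where "g m = 1 / (4 * \<bar>real_of_int m\<bar> * \<bar>real_of_int (m + int n)\<bar>)" for m
  have F: "F = (\<lambda>m. int n + 2 * m) ` M"
    using assms(2) by (auto simp: M_def J_def)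
  have inj: "inj_on (\<lambda>m. int n + 2 * m) M"
    by (auto simp: inj_on_def)
  have fin: "finite M"
    using assms(1) F inj finite_image_iff by metis
  have M0: "m \<noteq> 0 \<and> m \<noteq> - int n" if "m \<in> M" for m
    using that assms(2) by (auto simp: M_def J_def)
  have "(\<Sum>j\<in>F. 1 / \<bar>real_of_int ((int n)\<^sup>2 - j\<^sup>2)\<bar>) = (\<Sum>m\<in>M. g m)"
    unfolding F sum.reindex[OF inj] o_def
  proof (rule sum.cong)
    fix m
    have "real_of_int ((int n)\<^sup>2 - (int n + 2 * m)\<^sup>2) = - (4 * real_of_int m * real_of_int (m + int n))"
      by (simp add: power2_eq_square algebra_simps)
    then show "1 / \<bar>real_of_int ((int n)\<^sup>2 - (int n + 2 * m)\<^sup>2)\<bar> = g m"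
      by (simp only: g_def abs_minus_cancel abs_mult abs_numeral)
  qed simp
  also have "\<dots> \<le> harm n / real n"
  proof -
    obtain N where N: "\<And>m. m \<in> M \<Longrightarrow> \<bar>m\<bar> \<le> int N"
    proof (rule that[of "nat (\<Sum>m\<in>M. \<bar>m\<bar>)"])
      show "\<bar>m\<bar> \<le> int (nat (\<Sum>m\<in>M. \<bar>m\<bar>))" if "m \<in> M" for m
        using member_le_sum[OF that, of abs] fin by (simp add: sum_nonneg)
    qed
    define A B D where "A = int ` {1..N}" and "B = (\<lambda>p. - int p) ` {1..<n}"
      and "D = (\<lambda>p. - int n - int p) ` {1..N}"
    have "M \<subseteq> A \<union> B \<union> D"
    proof
      fix m assume m: "m \<in> M"
      consider "m > 0" | "m < 0" "m > - int n" | "m < - int n"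
        using M0[OF m] by linarith
      then show "m \<in> A \<union> B \<union> D"
      proof cases
        case 1
        then have "m = int (nat m)" "nat m \<in> {1..N}" using N[OF m] by auto
        then show ?thesis unfolding A_def by blast
      next
        case 2
        then have "m = - int (nat (- m))" "nat (- m) \<in> {1..<n}" by auto
        then show ?thesis unfolding B_def by blast
      next
        case 3
        then have "m = - int n - int (nat (- m - int n))" "nat (- m - int n) \<in> {1..N}"
          using N[OF m] by auto
        then show ?thesis unfolding D_def by blast
      qed
    qed
    then have "sum g M \<le> sum g (A \<union> B \<union> D)"
      by (intro sum_mono2) (auto simp: A_def B_def D_def g_def)
    also have "\<dots> \<le> sum g A + sum g B + sum g D"
    proof -
      have g0: "g m \<ge> 0" for m by (simp add: g_def)
      have "sum g (A \<union> B \<union> D) \<le> sum g (A \<union> B) + sum g D"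
        by (subst sum_Un) (auto simp: A_def B_def D_def intro!: sum_nonneg g0)
      moreover have "sum g (A \<union> B) \<le> sum g A + sum g B"
        by (subst sum_Un) (auto simp: A_def B_def intro!: sum_nonneg g0)
      ultimately show ?thesis by linarith
    qed
    also have "sum g A = (\<Sum>p=1..N. 1 / (real p * real (p + n))) / 4"
      unfolding A_def g_def by (subst sum.reindex) (auto simp: sum_divide_distrib intro!: sum.cong)
    also have "sum g B = (\<Sum>p=1..<n. 1 / (real p * real (n - p))) / 4"
      unfolding B_def g_def
      by (subst sum.reindex) (auto simp: inj_on_def sum_divide_distrib of_nat_diff intro!: sum.cong)
    also have "sum g D = (\<Sum>p=1..N. 1 / (real p * real (p + n))) / 4"
      unfolding D_def g_def
      by (subst sum.reindex) (auto simp: inj_on_def sum_divide_distrib algebra_simps abs_if intro!: sum.cong)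
    finally show ?thesis
      using sum_inverse_shifted_products_le_harm[OF assms(3), of N] sum_inverse_complementary_products_le_harm[of n]
      by simp
  qed
  finally show ?thesis .
qed

text \<open>\<open>H\<^sub>n - ln n\<close> decreases from 1, and \<open>ln n \<ge> 1\<close> from \<open>n = 3\<close> on.\<close>

lemma harm_le_2_ln:
  assumes "n \<ge> 3"
  shows "harm n \<le> 2 * ln (real n)"
proof -
  have "harm (Suc (n - 1)) - ln (real (Suc (n - 1))) \<le> harm (Suc 0) - ln (real (Suc 0))"
    using decseq_harm_diff_ln by (rule decseqD) simp
  then have "harm n - ln (real n) \<le> 1"
    using assms by (simp add: harm_def)
  moreover have "1 \<le> ln (real n)"
    using assms ln3_gt_1 ln_mono[of 3 "real n"] by linarith
  ultimately show ?thesis by linarith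
qed

text \<open>
  The smallest modulus of a denominator \<open>4m(m + n)\<close> occurs next to its zeros, where it is at least
  \<open>4(n - 1) \<ge> n\<close>; hence \<open>z\<close> cancels at most half of any of them.
\<close>

lemma norm_shifted_resonance_denominator_ge:
  fixes z :: complex
  assumes "j \<in> J n" "n \<ge> 2" "norm z \<le> real n / 2"
  shows "norm (of_int ((int n)\<^sup>2 - j\<^sup>2) + z) \<ge> \<bar>real_of_int ((int n)\<^sup>2 - j\<^sup>2)\<bar> / 2"
    and "(int n)\<^sup>2 - j\<^sup>2 \<noteq> 0"
proof -
  obtain m where m: "j = int n + 2 * m" "m \<noteq> 0" "m + int n \<noteq> 0"
    using assms(1) by (auto simp: J_def)
  have eq: "(int n)\<^sup>2 - j\<^sup>2 = - (4 * (m * (m + int n)))"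
    using m by (simp add: power2_eq_square algebra_simps)
  have "int n - 1 \<le> \<bar>m\<bar> * \<bar>m + int n\<bar>"
  proof -
    have "0 \<le> (\<bar>m\<bar> - 1) * (\<bar>m + int n\<bar> - 1)" using m by (intro mult_nonneg_nonneg) auto
    then show ?thesis by (simp add: algebra_simps)
  qed
  then have "int n \<le> \<bar>(int n)\<^sup>2 - j\<^sup>2\<bar>"
    unfolding eq using assms(2) by (simp add: abs_mult)
  then have *: "real n \<le> \<bar>real_of_int ((int n)\<^sup>2 - j\<^sup>2)\<bar>"
    by linarith
  have "\<bar>real_of_int ((int n)\<^sup>2 - j\<^sup>2)\<bar> - norm z \<le> norm (of_int ((int n)\<^sup>2 - j\<^sup>2) + z)"
    using norm_diff_ineq[of "of_int ((int n)\<^sup>2 - j\<^sup>2) :: complex" z] by (simp only: norm_of_int)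
  then show "norm (of_int ((int n)\<^sup>2 - j\<^sup>2) + z) \<ge> \<bar>real_of_int ((int n)\<^sup>2 - j\<^sup>2)\<bar> / 2"
    using * assms(3) by argo
  show "(int n)\<^sup>2 - j\<^sup>2 \<noteq> 0"
    unfolding eq using m by simp
qed

section \<open>Sums over finite tuples of indices\<close>

lemma norm_infsum_le_of_finite_sums:
  fixes f :: "'a \<Rightarrow> 'b :: banach"
  assumes "\<And>F. finite F \<Longrightarrow> F \<subseteq> A \<Longrightarrow> (\<Sum>x\<in>F. norm (f x)) \<le> B"
  shows "norm (infsum f A) \<le> B"
proof -
  have "f abs_summable_on A"
    by (rule nonneg_bdd_above_summable_on) (auto intro!: bdd_aboveI2 assms)
  then show ?thesis
    using norm_infsum_bound[of f A] infsum_le_finite_sums[of "\<lambda>x. norm (f x)" A B] assms by force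
qed

text \<open>
  A finite set of tuples lies in a finite box, over which the sum of products is a product of sums.
  With the preceding lemma, this bounds a sum over infinitely many tuples directly.
\<close>

lemma finite_sums_prod_PiE_le:
  fixes w :: "'b \<Rightarrow> real"
  assumes "finite I" "finite F" "F \<subseteq> I \<rightarrow>\<^sub>E A"
    and nonneg: "\<And>x. x \<in> A \<Longrightarrow> w x \<ge> 0"
    and bound: "\<And>G. finite G \<Longrightarrow> G \<subseteq> A \<Longrightarrow> sum w G \<le> t"
  shows "(\<Sum>j\<in>F. \<Prod>i\<in>I. w (j i)) \<le> t ^ card I"
proof -
  define G where "G = (\<Union>j\<in>F. j ` I)"
  have G: "finite G" "G \<subseteq> A" "F \<subseteq> I \<rightarrow>\<^sub>E G"
    using assms(1,2,3) by (auto simp: G_def PiE_iff extensional_def)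
  have "(\<Sum>j\<in>F. \<Prod>i\<in>I. w (j i)) \<le> (\<Sum>j\<in>I \<rightarrow>\<^sub>E G. \<Prod>i\<in>I. w (j i))"
    using G assms(1) nonneg by (intro sum_mono2 finite_PiE prod_nonneg) (auto simp: PiE_iff)
  also have "\<dots> = (\<Prod>i\<in>I. sum w G)"
    using prod_sum_PiE[OF assms(1), of "\<lambda>_. G" "\<lambda>_. w"] G by simp
  also have "\<dots> \<le> t ^ card I"
    using bound[OF G(1,2)] nonneg G(2) by (simp add: power_mono sum_nonneg subset_iff)
  finally show ?thesis .
qed

section \<open>Chains from one resonant index to the other\<close>

text \<open>
  The arguments of the \<open>k + 1\<close> factors are the steps of a path from \<open>-a\<close> through \<open>j\<^sub>1, \<dots>, j\<^sub>k\<close> to \<open>a\<close>,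
  up to sign. The value type is generic because the same product is taken of \<open>V\<close> and of the weight.
\<close>

definition chain_numerator :: "(int \<Rightarrow> 'a::comm_monoid_mult) \<Rightarrow> int \<Rightarrow> nat \<Rightarrow> (nat \<Rightarrow> int) \<Rightarrow> 'a" where
  "chain_numerator V a k j = V (- a - j 1) * (\<Prod>i=1..<k. V (j i - j (i + 1))) * V (j k - a)"

definition chain_sum :: "(int \<Rightarrow> complex) \<Rightarrow> int \<Rightarrow> nat \<Rightarrow> nat \<Rightarrow> complex \<Rightarrow> complex" where
  "chain_sum V a k n z = (\<Sum>\<^sub>\<infinity> j \<in> {1..k} \<rightarrow>\<^sub>E J n.
     chain_numerator V a k j / (\<Prod>i=1..k. of_int ((int n)\<^sup>2 - (j i)\<^sup>2) + z))"

lemma S12_eq_chain_sum: "S12 V k n z = chain_sum V (int n) k n z"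
  by (simp add: S12_def chain_sum_def chain_numerator_def)

lemma S21_eq_chain_sum: "S21 V k n z = chain_sum V (- int n) k n z"
  by (simp add: S21_def chain_sum_def chain_numerator_def)

text \<open>
  The steps of the chain telescope: those up to \<open>j\<^sub>k\<close> add up to \<open>-a - j\<^sub>k\<close>, and the last one completes
  \<open>-2a\<close>. Each of the \<open>k\<close> additions costs one factor \<open>C\<close>.
\<close>

lemma almost_submultiplicative_chain:
  fixes \<Omega> :: "int \<Rightarrow> real"
  assumes pos: "\<And>k. even k \<Longrightarrow> \<Omega> k > 0" and "C > 0"
    and sub: "\<And>k m. even k \<Longrightarrow> even m \<Longrightarrow> \<Omega> (k + m) \<le> C * \<Omega> k * \<Omega> m"
    and "k \<ge> 1" and even: "\<And>i. i \<in> {1..k} \<Longrightarrow> even (j i - a)"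
  shows "\<Omega> (- 2 * a) \<le> C ^ k * chain_numerator \<Omega> a k j"
proof -
  have *: "\<Omega> (- a - j k) \<le> C ^ (k - 1) * (\<Omega> (- a - j 1) * (\<Prod>i=1..<k. \<Omega> (j i - j (i + 1))))"
    using \<open>k \<ge> 1\<close> even
  proof (induction k rule: dec_induct)
    case (step k)
    have e: "even (- a - j k)" "even (j k - j (k + 1))"
      using step.prems[of k] step.prems[of "Suc k"] step.hyps by auto
    have "\<Omega> (- a - j (Suc k)) = \<Omega> ((- a - j k) + (j k - j (k + 1)))" by simp
    also have "\<dots> \<le> C * \<Omega> (- a - j k) * \<Omega> (j k - j (k + 1))"
      by (rule sub[OF e])
    also have "\<dots> \<le> C * (C ^ (k - 1) * (\<Omega> (- a - j 1) * (\<Prod>i=1..<k. \<Omega> (j i - j (i + 1)))))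
        * \<Omega> (j k - j (k + 1))"
      using step.prems \<open>C > 0\<close> pos[OF e(2)] by (intro mult_right_mono mult_left_mono step.IH) auto
    also have "\<dots> = C ^ k * (\<Omega> (- a - j 1) * (\<Prod>i=1..<Suc k. \<Omega> (j i - j (i + 1))))"
      using step.hyps power_Suc[of C "k - 1"] by (simp add: mult_ac del: power_Suc)
    finally show ?case by simp
  qed simp
  have e: "even (- a - j k)" "even (j k - a)"
    using even[of k] \<open>k \<ge> 1\<close> by auto
  have "\<Omega> (- 2 * a) = \<Omega> ((- a - j k) + (j k - a))" by simp
  also have "\<dots> \<le> C * \<Omega> (- a - j k) * \<Omega> (j k - a)"
    by (rule sub[OF e])
  also have "\<dots> \<le> C * (C ^ (k - 1) * (\<Omega> (- a - j 1) * (\<Prod>i=1..<k. \<Omega> (j i - j (i + 1))))) * \<Omega> (j k - a)"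
    using \<open>C > 0\<close> pos[OF e(2)] by (intro mult_right_mono mult_left_mono *) auto
  also have "\<dots> = C ^ k * chain_numerator \<Omega> a k j"
    using \<open>k \<ge> 1\<close> power_Suc[of C "k - 1"] by (simp add: chain_numerator_def mult_ac del: power_Suc)
  finally show ?thesis .
qed

text \<open>
  The two end factors are kept together in the bound \<open>D\<close>, because for \<open>k = 1\<close> they share the index
  \<open>j\<^sub>1\<close> and cannot both have small arguments.
\<close>

lemma norm_chain_numerator_le:
  fixes \<Omega> :: "int \<Rightarrow> real" and V :: "int \<Rightarrow> complex"
  assumes pos: "\<And>k. even k \<Longrightarrow> \<Omega> k > 0" and "C > 0"
    and sub: "\<And>k m. even k \<Longrightarrow> even m \<Longrightarrow> \<Omega> (k + m) \<le> C * \<Omega> k * \<Omega> m"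
    and M: "\<And>k. even k \<Longrightarrow> norm (V k) * \<Omega> k \<le> M"
    and k: "k \<ge> 1" and even: "\<And>i. i \<in> {1..k} \<Longrightarrow> even (j i - a)"
    and D: "(norm (V (- a - j 1)) * \<Omega> (- a - j 1)) * (norm (V (j k - a)) * \<Omega> (j k - a)) \<le> D"
  shows "norm (chain_numerator V a k j) * \<Omega> (- 2 * a) \<le> C ^ k * M ^ (k - 1) * D"
proof -
  define e where "e m = norm (V m) * \<Omega> m" for m
  have ev: "even (j i - j (i + 1))" if "i \<in> {1..<k}" for i
    using even[of i] even[of "i + 1"] that by auto
  have ev1: "even (- a - j 1)" "even (j k - a)"
    using even[of 1] even[of k] k by auto
  have e0: "0 \<le> e m" if "even m" for m
    using pos[OF that] by (simp add: e_def)
  have "norm (chain_numerator V a k j) * \<Omega> (- 2 * a)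
      \<le> norm (chain_numerator V a k j) * (C ^ k * chain_numerator \<Omega> a k j)"
    by (intro mult_left_mono almost_submultiplicative_chain[OF pos \<open>C > 0\<close> sub k even]) auto
  also have "\<dots> = C ^ k * ((\<Prod>i=1..<k. e (j i - j (i + 1))) * (e (- a - j 1) * e (j k - a)))"
    by (simp add: chain_numerator_def e_def norm_mult prod_norm[symmetric] prod.distrib mult_ac)
  also have "\<dots> \<le> C ^ k * (M ^ (k - 1) * D)"
  proof (intro mult_left_mono mult_mono)
    show "(\<Prod>i=1..<k. e (j i - j (i + 1))) \<le> M ^ (k - 1)"
      using prod_mono[of "{1..<k}" "\<lambda>i. e (j i - j (i + 1))" "\<lambda>_. M"] ev e0 M
      by (simp add: e_def)
    show "e (- a - j 1) * e (j k - a) \<le> D" using D by (simp add: e_def)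
    show "0 \<le> M ^ (k - 1)" using order_trans[OF e0[of 0] M[of 0, folded e_def]] by simp
    show "0 \<le> e (- a - j 1) * e (j k - a)" using e0 ev1 by simp
  qed (use \<open>C > 0\<close> in simp)
  finally show ?thesis by (simp add: mult_ac)
qed

text \<open>All indices have the parity of \<open>n\<close>, so only even arguments of \<open>V\<close> and \<open>\<Omega>\<close> occur.\<close>

lemma even_J_minus_endpoint:
  assumes "j \<in> J n" "\<bar>a\<bar> = int n"
  shows "even (j - a)" "even (- a - j)"
proof -
  obtain m where "j = int n + 2 * m" using assms(1) by (auto simp: J_def)
  moreover have "a = int n \<or> a = - int n" using assms(2) by linarith
  ultimately show "even (j - a)" by auto
  then show "even (- a - j)" by presburger
qed

text \<open>
  The bound for the numerators is independent of the indices, so only the product of the reciprocal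
  denominators has to be summed.
\<close>

lemma norm_chain_sum_le:
  fixes \<Omega> :: "int \<Rightarrow> real" and V :: "int \<Rightarrow> complex"
  assumes pos: "\<And>k. even k \<Longrightarrow> \<Omega> k > 0" and "C > 0"
    and sub: "\<And>k m. even k \<Longrightarrow> even m \<Longrightarrow> \<Omega> (k + m) \<le> C * \<Omega> k * \<Omega> m"
    and M: "\<And>k. even k \<Longrightarrow> norm (V k) * \<Omega> k \<le> M"
    and k: "k \<ge> 1" and n: "n \<ge> 3" and z: "norm z \<le> real n / 2" and a: "\<bar>a\<bar> = int n"
    and D: "\<And>j. j \<in> {1..k} \<rightarrow>\<^sub>E J n \<Longrightarrow>
      (norm (V (- a - j 1)) * \<Omega> (- a - j 1)) * (norm (V (j k - a)) * \<Omega> (j k - a)) \<le> D"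
  shows "norm (chain_sum V a k n z) * \<Omega> (- 2 * a) \<le> C ^ k * M ^ (k - 1) * D * (4 * ln n / n) ^ k"
proof -
  define w where "w j = 2 * (1 / \<bar>real_of_int ((int n)\<^sup>2 - j\<^sup>2)\<bar>)" for j
  define K where "K = C ^ k * M ^ (k - 1) * D / \<Omega> (- 2 * a)"
  have \<Omega>: "\<Omega> (- 2 * a) > 0" by (rule pos) simp
  have num: "norm (chain_numerator V a k j) \<le> K" if j: "j \<in> {1..k} \<rightarrow>\<^sub>E J n" for j
  proof -
    have "even (j i - a)" if "i \<in> {1..k}" for i
      by (rule even_J_minus_endpoint(1)[OF PiE_mem[OF j that] a])
    from norm_chain_numerator_le[where V = V and \<Omega> = \<Omega>, OF pos \<open>C > 0\<close> sub M k this D[OF j]] show ?thesis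
      using \<Omega> by (simp add: K_def pos_le_divide_eq)
  qed
  \<comment> \<open>\<open>w\<close> is twice the reciprocal unshifted denominator; \<open>H\<^sub>n \<le> 2 ln n\<close> gives the other factor 2.\<close>
  have wt: "sum w G \<le> 4 * ln n / n" if "finite G" "G \<subseteq> J n" for G
  proof -
    have "sum w G \<le> 2 * (harm n / n)"
      unfolding w_def sum_distrib_left[symmetric]
      using sum_resonance_denominators_le[OF that] n by (intro mult_left_mono) auto
    also have "\<dots> \<le> 2 * (2 * ln n / n)"
      using harm_le_2_ln[OF n] by (intro mult_left_mono divide_right_mono) auto
    finally show ?thesis by simp
  qed
  have "norm (chain_sum V a k n z) \<le> K * (4 * ln n / n) ^ k"
    unfolding chain_sum_def
  proof (rule norm_infsum_le_of_finite_sums)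
    fix F assume F: "finite F" "F \<subseteq> {1..k} \<rightarrow>\<^sub>E J n"
    have "F \<noteq> {} \<Longrightarrow> 0 \<le> K" using num F norm_ge_zero order_trans by blast
    have "(\<Sum>j\<in>F. norm (chain_numerator V a k j / (\<Prod>i=1..k. of_int ((int n)\<^sup>2 - (j i)\<^sup>2) + z)))
        \<le> (\<Sum>j\<in>F. K * (\<Prod>i\<in>{1..k}. w (j i)))"
    proof (rule sum_mono)
      fix j assume "j \<in> F"
      then have j: "j \<in> {1..k} \<rightarrow>\<^sub>E J n" using F by auto
      have d: "inverse (norm (of_int ((int n)\<^sup>2 - (j i)\<^sup>2) + z)) \<le> w (j i)" if "i \<in> {1..k}" for i
      proof -
        have ji: "j i \<in> J n" using j that by auto
        define r where "r = \<bar>real_of_int ((int n)\<^sup>2 - (j i)\<^sup>2)\<bar>"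
        have "r / 2 \<le> norm (of_int ((int n)\<^sup>2 - (j i)\<^sup>2) + z)"
          using norm_shifted_resonance_denominator_ge(1)[OF ji _ z] n by (simp only: r_def)
        moreover have "0 < r"
          using norm_shifted_resonance_denominator_ge(2)[OF ji _ z] n unfolding r_def by linarith
        ultimately have "inverse (norm (of_int ((int n)\<^sup>2 - (j i)\<^sup>2) + z)) \<le> inverse (r / 2)"
          by (intro le_imp_inverse_le) auto
        also have "inverse (r / 2) = w (j i)"
          by (simp only: w_def r_def inverse_divide mult_1_right times_divide_eq_right)
        finally show ?thesis .
      qed
      have "norm (chain_numerator V a k j / (\<Prod>i=1..k. of_int ((int n)\<^sup>2 - (j i)\<^sup>2) + z))
          = norm (chain_numerator V a k j) * (\<Prod>i=1..k. inverse (norm (of_int ((int n)\<^sup>2 - (j i)\<^sup>2) + z)))"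
        using prod_inversef[of "\<lambda>i. norm (of_int ((int n)\<^sup>2 - (j i)\<^sup>2) + z)" "{1..k}"]
        by (simp only: divide_inverse norm_mult norm_inverse prod_norm[symmetric] o_def)
      also have "\<dots> \<le> K * (\<Prod>i=1..k. w (j i))"
        using num[OF j] d \<open>j \<in> F\<close> \<open>F \<noteq> {} \<Longrightarrow> 0 \<le> K\<close>
        by (intro mult_mono prod_mono prod_nonneg) auto
      finally show "norm (chain_numerator V a k j / (\<Prod>i=1..k. of_int ((int n)\<^sup>2 - (j i)\<^sup>2) + z))
          \<le> K * (\<Prod>i\<in>{1..k}. w (j i))" .
    qed
    also have "\<dots> \<le> K * (4 * ln n / n) ^ k"
    proof -
      \<comment> \<open>Any tuple at all shows that the uniform bound \<open>K\<close> is nonnegative.\<close>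
      have "int n + 2 \<in> J n" using n by (auto simp: J_def intro!: exI[of _ 1])
      then have "(\<lambda>i\<in>{1..k}. int n + 2) \<in> {1..k} \<rightarrow>\<^sub>E J n" by auto
      from num[OF this] have "0 \<le> K" using norm_ge_zero order_trans by blast
      then show ?thesis
        using finite_sums_prod_PiE_le[OF _ F, of w "4 * ln n / n"] wt
        by (simp add: sum_distrib_left[symmetric] mult_left_mono w_def)
    qed
    finally show "(\<Sum>j\<in>F. norm (chain_numerator V a k j / (\<Prod>i=1..k. of_int ((int n)\<^sup>2 - (j i)\<^sup>2) + z)))
        \<le> K * (4 * ln n / n) ^ k" .
  qed
  then have "norm (chain_sum V a k n z) * \<Omega> (- 2 * a) \<le> K * (4 * ln n / n) ^ k * \<Omega> (- 2 * a)"
    using \<Omega> by (intro mult_right_mono) auto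
  then show ?thesis
    using \<Omega> by (simp add: K_def)
qed

text \<open>
  The first term is linear in \<open>t = 4 ln n / n\<close> and would be too large in the case where \<open>|V| \<Omega>\<close>
  tends to 0; there the factor \<open>\<epsilon>\<close> is what makes it negligible. All later terms together are of order
  \<open>t\<^sup>2\<close>, for which the crude bound \<open>M\<close> suffices.
\<close>

lemma norm_chain_series_le:
  fixes \<Omega> :: "int \<Rightarrow> real" and V :: "int \<Rightarrow> complex"
  assumes pos: "\<And>k. even k \<Longrightarrow> \<Omega> k > 0" and "C > 0"
    and sub: "\<And>k m. even k \<Longrightarrow> even m \<Longrightarrow> \<Omega> (k + m) \<le> C * \<Omega> k * \<Omega> m"
    and M: "\<And>k. even k \<Longrightarrow> norm (V k) * \<Omega> k \<le> M"
    and \<epsilon>: "\<And>k. even k \<Longrightarrow> int n \<le> \<bar>k\<bar> \<Longrightarrow> norm (V k) * \<Omega> k \<le> \<epsilon>"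
    and n: "n \<ge> 3" and z: "norm z \<le> real n / 2" and a: "\<bar>a\<bar> = int n"
    and small: "C * M * (4 * ln n / n) \<le> 1 / 2"
  shows "norm (\<Sum>k. chain_sum V a (Suc k) n z) * \<Omega> (- 2 * a)
    \<le> (4 * ln n / n) * (C * M * \<epsilon> + 2 * C\<^sup>2 * M ^ 3 * (4 * ln n / n))"
proof -
  define t where "t = 4 * ln n / n"
  define q where "q = C * M * t"
  have \<Omega>: "\<Omega> (- 2 * a) > 0" by (rule pos) simp
  have e0: "0 \<le> norm (V m) * \<Omega> m" if "even m" for m
    using pos[OF that] by simp
  have M0: "0 \<le> M" using order_trans[OF e0[of 0] M[of 0]] by simp
  have t0: "0 \<le> t" using n by (simp add: t_def)
  have q: "0 \<le> q" "q \<le> 1 / 2"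
    using M0 t0 \<open>C > 0\<close> small[folded t_def] by (auto simp: q_def)
  note parity = even_J_minus_endpoint[OF _ a]
  have inJ: "j i \<in> J n" if "j \<in> {1..k} \<rightarrow>\<^sub>E J n" "i \<in> {1..k}" for j :: "nat \<Rightarrow> int" and i k
    using that by auto
  have first: "norm (chain_sum V a 1 n z) * \<Omega> (- 2 * a) \<le> C ^ 1 * M ^ (1 - 1) * (M * \<epsilon>) * (4 * ln n / n) ^ 1"
  proof (rule norm_chain_sum_le[where V = V and \<Omega> = \<Omega>, OF pos \<open>C > 0\<close> sub M order_refl n z a])
    fix j :: "nat \<Rightarrow> int" assume j: "j \<in> {1..1} \<rightarrow>\<^sub>E J n"
    note ev = parity[OF inJ[OF j, of 1]]
    \<comment> \<open>The two arguments add up to \<open>-2a\<close>, so they cannot both be smaller than \<open>n\<close>.\<close>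
    have "int n \<le> \<bar>- a - j 1\<bar> \<or> int n \<le> \<bar>j 1 - a\<bar>" using a by linarith
    then show "norm (V (- a - j 1)) * \<Omega> (- a - j 1) * (norm (V (j 1 - a)) * \<Omega> (j 1 - a)) \<le> M * \<epsilon>"
    proof
      assume "int n \<le> \<bar>- a - j 1\<bar>"
      then have "norm (V (- a - j 1)) * \<Omega> (- a - j 1) * (norm (V (j 1 - a)) * \<Omega> (j 1 - a)) \<le> \<epsilon> * M"
        using ev by (intro mult_mono' \<epsilon> M e0) auto
      then show ?thesis by (simp add: mult.commute)
    next
      assume "int n \<le> \<bar>j 1 - a\<bar>"
      then show ?thesis
        using ev by (intro mult_mono' \<epsilon> M e0) auto
    qed
  qed
  have rest: "norm (chain_sum V a (Suc (Suc k)) n z) \<le> M * q\<^sup>2 / \<Omega> (- 2 * a) * q ^ k" for k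
  proof -
    have "norm (chain_sum V a (Suc (Suc k)) n z) * \<Omega> (- 2 * a)
      \<le> C ^ Suc (Suc k) * M ^ (Suc (Suc k) - 1) * (M * M) * (4 * ln n / n) ^ Suc (Suc k)"
    proof (rule norm_chain_sum_le[where V = V and \<Omega> = \<Omega>, OF pos \<open>C > 0\<close> sub M _ n z a])
      fix j assume j: "j \<in> {1..Suc (Suc k)} \<rightarrow>\<^sub>E J n"
      show "norm (V (- a - j 1)) * \<Omega> (- a - j 1)
          * (norm (V (j (Suc (Suc k)) - a)) * \<Omega> (j (Suc (Suc k)) - a)) \<le> M * M"
        using parity[OF inJ[OF j, of 1]] parity[OF inJ[OF j, of "Suc (Suc k)"]]
        by (intro mult_mono' M e0) auto
    qed auto
    also have "\<dots> = M * q\<^sup>2 * q ^ k"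
      unfolding q_def t_def[symmetric] by (simp add: power_mult_distrib power2_eq_square mult_ac)
    finally show ?thesis using \<Omega> by (simp add: pos_le_divide_eq)
  qed
  have geometric: "(\<lambda>k. M * q\<^sup>2 / \<Omega> (- 2 * a) * q ^ k) sums (M * q\<^sup>2 / \<Omega> (- 2 * a) * (1 / (1 - q)))"
    using q by (intro sums_mult geometric_sums) auto
  have summ: "summable (\<lambda>k. chain_sum V a (Suc (Suc k)) n z)"
    by (rule summable_comparison_test'[OF sums_summable[OF geometric] rest])
  have "norm (\<Sum>k. chain_sum V a (Suc (Suc k)) n z) \<le> M * q\<^sup>2 / \<Omega> (- 2 * a) * (1 / (1 - q))"
    using norm_suminf_le[OF rest sums_summable[OF geometric]] sums_unique[OF geometric] by simp
  also have "\<dots> \<le> M * q\<^sup>2 / \<Omega> (- 2 * a) * 2"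
    using q M0 \<Omega> by (intro mult_left_mono) (auto simp: divide_simps)
  finally have tail: "norm (\<Sum>k. chain_sum V a (Suc (Suc k)) n z) * \<Omega> (- 2 * a) \<le> 2 * M * q\<^sup>2"
    using \<Omega> by (simp add: field_simps)
  have "(\<Sum>k. chain_sum V a (Suc k) n z) = (\<Sum>k. chain_sum V a (Suc (Suc k)) n z) + chain_sum V a 1 n z"
    using suminf_split_head[of "\<lambda>k. chain_sum V a (Suc k) n z"] summ summable_Suc_iff[of "\<lambda>k. chain_sum V a (Suc k) n z"] 
    by simp
  then have "norm (\<Sum>k. chain_sum V a (Suc k) n z) * \<Omega> (- 2 * a)
      \<le> (norm (\<Sum>k. chain_sum V a (Suc (Suc k)) n z) + norm (chain_sum V a 1 n z)) * \<Omega> (- 2 * a)"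
    using \<Omega> by (simp add: norm_triangle_ineq)
  also have "\<dots> \<le> 2 * M * q\<^sup>2 + C * (M * \<epsilon>) * t"
    using tail first by (simp add: distrib_right t_def)
  also have "\<dots> = t * (C * M * \<epsilon> + 2 * C\<^sup>2 * M ^ 3 * t)"
    by (simp add: q_def algebra_simps power2_eq_square power3_eq_cube)
  finally show ?thesis by (simp only: t_def)
qed

section \<open>Passage to the limit\<close>

lemma sim_on_discsI:
  assumes "((\<lambda>n. g n) \<longlongrightarrow> (0::real)) (to_infinity_in \<Delta>)"
    and "\<forall>\<^sub>F n in to_infinity_in \<Delta>. \<forall>z. norm z \<le> real n / 2 \<longrightarrow> norm (\<beta> n z / a n - 1) \<le> g n"
  shows "sim_on_discs \<beta> a \<Delta>"
  unfolding sim_on_discs_def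
proof (rule tendsto_sandwich)
  show "\<forall>\<^sub>F n in to_infinity_in \<Delta>. 0 \<le> (SUP z\<in>{z. norm z \<le> real n / 2}. ereal (norm (\<beta> n z / a n - 1)))"
    by (intro always_eventually allI SUP_upper2[of 0]) auto
  show "\<forall>\<^sub>F n in to_infinity_in \<Delta>.
      (SUP z\<in>{z. norm z \<le> real n / 2}. ereal (norm (\<beta> n z / a n - 1))) \<le> ereal (g n)"
    using assms(2) by eventually_elim (auto intro!: SUP_least)
  show "((\<lambda>n. ereal (g n)) \<longlongrightarrow> 0) (to_infinity_in \<Delta>)"
    using assms(1) by (simp add: zero_ereal_def)
qed simp

lemma ln_over_n_tendsto_0: "(\<lambda>n. ln (real n) / real n) \<longlonglongrightarrow> 0"
  using lim_ln_over_n .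

lemma to_infinity_in_le: "to_infinity_in \<Delta> \<le> at_top"
  by (simp add: to_infinity_in_def)

text \<open>
  The quantity \<open>r n\<close> is the one on which both sets of hypotheses are imposed. Dividing the bound of
  \<open>norm_chain_series_le\<close> by \<open>|V(-2a)| \<Omega>(-2a) = r n (ln n / n)\<close> cancels its leading factor
  \<open>ln n / n\<close>.
\<close>

lemma sim_on_discs_chain_series:
  fixes \<Omega> :: "int \<Rightarrow> real" and V :: "int \<Rightarrow> complex" and a :: "nat \<Rightarrow> int"
  defines "r \<equiv> \<lambda>n. norm (V (- 2 * a n)) * (real n / ln (real n)) * \<Omega> (- 2 * a n)"
  assumes pos: "\<And>k. even k \<Longrightarrow> \<Omega> k > 0" and "C > 0"
    and sub: "\<And>k m. even k \<Longrightarrow> even m \<Longrightarrow> \<Omega> (k + m) \<le> C * \<Omega> k * \<Omega> m"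
    and M: "\<And>k. even k \<Longrightarrow> norm (V k) * \<Omega> k \<le> M"
    and \<epsilon>: "\<And>n k. even k \<Longrightarrow> int n \<le> \<bar>k\<bar> \<Longrightarrow> norm (V k) * \<Omega> k \<le> \<epsilon> n"
    and a: "\<And>n. \<bar>a n\<bar> = int n"
    and r_pos: "\<forall>\<^sub>F n in to_infinity_in \<Delta>. r n > 0"
    and lim1: "((\<lambda>n. \<epsilon> n / r n) \<longlongrightarrow> 0) (to_infinity_in \<Delta>)"
    and lim2: "((\<lambda>n. (ln (real n) / real n) / r n) \<longlongrightarrow> 0) (to_infinity_in \<Delta>)"
  shows "sim_on_discs (\<lambda>n z. V (- 2 * a n) + (\<Sum>k. chain_sum V (a n) (Suc k) n z))
    (\<lambda>n. V (- 2 * a n)) \<Delta>"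
proof (rule sim_on_discsI)
  let ?g = "\<lambda>n. 4 * C * M * (\<epsilon> n / r n) + 32 * C\<^sup>2 * M ^ 3 * ((ln (real n) / real n) / r n)"
  show "(?g \<longlongrightarrow> 0) (to_infinity_in \<Delta>)"
    using tendsto_add[OF tendsto_mult_left[OF lim1, of "4 * C * M"]
        tendsto_mult_left[OF lim2, of "32 * C\<^sup>2 * M ^ 3"]] by simp
  have "(\<lambda>n. C * M * (4 * (ln (real n) / real n))) \<longlonglongrightarrow> 0"
    using tendsto_mult_left[OF ln_over_n_tendsto_0, of "C * M * 4"] by (simp add: mult_ac)
  then have "\<forall>\<^sub>F n in at_top. C * M * (4 * (ln (real n) / real n)) < 1 / 2"
    by (rule order_tendstoD) simp
  then have "\<forall>\<^sub>F n in to_infinity_in \<Delta>. C * M * (4 * (ln (real n) / real n)) < 1 / 2"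
    by (rule filter_leD[OF to_infinity_in_le])
  moreover have "\<forall>\<^sub>F n in to_infinity_in \<Delta>. n \<ge> 3"
    by (rule filter_leD[OF to_infinity_in_le]) (rule eventually_ge_at_top)
  ultimately show "\<forall>\<^sub>F n in to_infinity_in \<Delta>. \<forall>z. norm z \<le> real n / 2 \<longrightarrow>
      norm ((V (- 2 * a n) + (\<Sum>k. chain_sum V (a n) (Suc k) n z)) / V (- 2 * a n) - 1) \<le> ?g n"
    using r_pos
  proof eventually_elim
    case (elim n)
    show ?case
    proof (intro allI impI)
      fix z :: complex assume z: "norm z \<le> real n / 2"
      define v w L where "v = norm (V (- 2 * a n))" and "w = \<Omega> (- 2 * a n)" and "L = ln (real n) / real n"
      define s where "s = (\<Sum>k. chain_sum V (a n) (Suc k) n z)"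
      have w: "w > 0" unfolding w_def by (rule pos) simp
      have L: "L > 0" using elim by (simp add: L_def)
      have r: "r n = v * w / L" by (simp add: r_def v_def w_def L_def)
      have v: "v > 0" using elim(3) w L by (auto simp: r v_def)
      have "norm s * w \<le> 4 * L * (C * M * \<epsilon> n + 2 * C\<^sup>2 * M ^ 3 * (4 * L))"
        using norm_chain_series_le[where V = V and \<Omega> = \<Omega>, OF pos \<open>C > 0\<close> sub M \<epsilon> elim(2) z a] elim(1)
        by (simp add: s_def w_def L_def)
      then have "norm s / v \<le> 4 * L * (C * M * \<epsilon> n + 2 * C\<^sup>2 * M ^ 3 * (4 * L)) / (v * w)"
        using v w by (simp add: field_simps)
      also have "\<dots> = ?g n"
        unfolding r L_def[symmetric] using v w L by (simp add: field_simps)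
      also have "norm s / v = norm ((V (- 2 * a n) + s) / V (- 2 * a n) - 1)"
        using v by (simp add: v_def norm_divide[symmetric] add_divide_distrib)
      finally show "norm ((V (- 2 * a n) + (\<Sum>k. chain_sum V (a n) (Suc k) n z)) / V (- 2 * a n) - 1) \<le> ?g n"
        by (simp only: s_def)
    qed
  qed
qed

lemma W_infty_bounded:
  assumes "v \<in> W_infty \<Omega>"
  obtains M where "\<And>k. even k \<Longrightarrow> norm (fourier_coeff v k) * \<Omega> k \<le> M"
proof -
  have fin: "weighted_norm \<Omega> v < \<infinity>" using assms by (simp add: W_infty_def)
  have le: "ereal (norm (fourier_coeff v k) * \<Omega> k) \<le> weighted_norm \<Omega> v" if "even k" for k
    unfolding weighted_norm_def using that by (intro SUP_upper) simp
  show ?thesis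
  proof (cases "weighted_norm \<Omega> v")
    case (real M)
    then show ?thesis using le that[of M] by simp
  qed (use fin le[of 0] in auto)
qed

lemma beta_minus_eq_chain_series:
  "beta_minus v = (\<lambda>n z. fourier_coeff v (- 2 * int n)
     + (\<Sum>k. chain_sum (fourier_coeff v) (int n) (Suc k) n z))"
  by (simp add: beta_minus_def S12_eq_chain_sum fun_eq_iff)

lemma beta_plus_eq_chain_series:
  "beta_plus v = (\<lambda>n z. fourier_coeff v (- 2 * - int n)
     + (\<Sum>k. chain_sum (fourier_coeff v) (- int n) (Suc k) n z))"
  by (simp add: beta_plus_def S21_eq_chain_sum fun_eq_iff)

text \<open>
  This supplies the bounds \<open>\<epsilon>\<^sub>n\<close> in the case where \<open>|V| \<Omega>\<close> tends to 0.
\<close>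

lemma even_tail_SUP:
  fixes e :: "int \<Rightarrow> real"
  defines "E \<equiv> \<lambda>n::nat. SUP k\<in>{k. even k \<and> int n \<le> \<bar>k\<bar>}. e k"
  assumes nonneg: "\<And>k. even k \<Longrightarrow> e k \<ge> 0" and M: "\<And>k. even k \<Longrightarrow> e k \<le> M"
    and lim: "(e \<longlongrightarrow> 0) (inf (filtercomap (\<lambda>k. \<bar>k\<bar>) at_top) (principal {k. even k}))"
  shows "\<And>n k. even k \<Longrightarrow> int n \<le> \<bar>k\<bar> \<Longrightarrow> e k \<le> E n" and "E \<longlonglongrightarrow> 0"
proof -
  show upper: "e k \<le> E n" if "even k" "int n \<le> \<bar>k\<bar>" for n k
    unfolding E_def using that M by (intro cSUP_upper bdd_aboveI2) auto
  show "E \<longlonglongrightarrow> 0"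
  proof (rule order_tendstoI)
    fix b :: real assume "b < 0"
    then show "\<forall>\<^sub>F n in at_top. b < E n"
      using less_le_trans[OF less_le_trans[OF _ nonneg] upper[of "2 * int n" n for n]] by simp
  next
    fix b :: real assume b: "0 < b"
    have "\<forall>\<^sub>F k in inf (filtercomap (\<lambda>k. \<bar>k\<bar>) at_top) (principal {k. even k}). e k < b / 2"
      using lim b by (intro order_tendstoD) auto
    then obtain K :: int where K: "\<And>k. even k \<Longrightarrow> K \<le> \<bar>k\<bar> \<Longrightarrow> e k < b / 2"
      by (auto simp: eventually_inf_principal eventually_filtercomap eventually_at_top_linorder)
    have "E n < b" if "n \<ge> nat K" for n
    proof -
      have "E n \<le> b / 2"
        unfolding E_def
      proof (rule cSUP_least)
        show "{k. even k \<and> int n \<le> \<bar>k\<bar>} \<noteq> {}" by (auto intro!: exI[of _ "2 * int n"])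
      qed (use K that in \<open>auto intro!: less_imp_le\<close>)
      then show ?thesis using b by linarith
    qed
    then show "\<forall>\<^sub>F n in at_top. E n < b" by (auto simp: eventually_at_top_linorder)
  qed
qed

text \<open>
  The two alternatives differ only in the tail bound: the constant \<open>M\<close> when \<open>r\<close> tends to infinity,
  the tail supremum, which tends to 0, when \<open>r\<close> is merely bounded below.
\<close>

lemma sim_on_discs_of_weighted_size:
  fixes \<Omega> :: "int \<Rightarrow> real" and V :: "int \<Rightarrow> complex" and a :: "nat \<Rightarrow> int"
  defines "r \<equiv> \<lambda>n. norm (V (- 2 * a n)) * (real n / ln (real n)) * \<Omega> (- 2 * a n)"
  assumes pos: "\<And>k. even k \<Longrightarrow> \<Omega> k > 0" and "almost_submultiplicative \<Omega>"
    and M: "\<And>k. even k \<Longrightarrow> norm (V k) * \<Omega> k \<le> M"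
    and a: "\<And>n. \<bar>a n\<bar> = int n"
    and cases: "filterlim r at_top (to_infinity_in \<Delta>) \<or>
      ((\<lambda>k. norm (V k) * \<Omega> k) \<longlongrightarrow> 0)
        (inf (filtercomap (\<lambda>k. \<bar>k\<bar>) at_top) (principal {k. even k})) \<and>
      (\<exists>c>0. \<forall>n\<in>\<Delta>. n \<ge> 2 \<longrightarrow> c \<le> r n)"
  shows "sim_on_discs (\<lambda>n z. V (- 2 * a n) + (\<Sum>k. chain_sum V (a n) (Suc k) n z))
    (\<lambda>n. V (- 2 * a n)) \<Delta>"
proof -
  obtain C where C: "C > 0" "\<And>k m. even k \<Longrightarrow> even m \<Longrightarrow> \<Omega> (k + m) \<le> C * \<Omega> k * \<Omega> m"
    using assms(3) by (auto simp: almost_submultiplicative_def)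
  have r_eq: "r n = norm (V (- 2 * a n)) * (real n / ln (real n)) * \<Omega> (- 2 * a n)" for n
    by (simp add: r_def)
  note * = sim_on_discs_chain_series[where V = V and \<Omega> = \<Omega>, OF pos C M _ a, folded r_eq]
  have ln0: "((\<lambda>n. ln (real n) / real n) \<longlongrightarrow> 0) (to_infinity_in \<Delta>)"
    by (rule tendsto_mono[OF to_infinity_in_le ln_over_n_tendsto_0])
  from cases show ?thesis
  proof (elim disjE conjE exE)
    assume r: "filterlim r at_top (to_infinity_in \<Delta>)"
    show ?thesis
    proof (rule *[where \<epsilon> = "\<lambda>_. M"])
      show "\<forall>\<^sub>F n in to_infinity_in \<Delta>. 0 < r n"
        using r by (simp add: filterlim_at_top_dense)
      show "((\<lambda>n. M / r n) \<longlongrightarrow> 0) (to_infinity_in \<Delta>)"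
        by (rule real_tendsto_divide_at_top[OF tendsto_const r])
      show "((\<lambda>n. ln (real n) / real n / r n) \<longlongrightarrow> 0) (to_infinity_in \<Delta>)"
        by (rule real_tendsto_divide_at_top[OF ln0 r])
    qed (use M in auto)
  next
    fix c :: real
    assume lim: "((\<lambda>k. norm (V k) * \<Omega> k) \<longlongrightarrow> 0)
        (inf (filtercomap (\<lambda>k. \<bar>k\<bar>) at_top) (principal {k. even k}))"
      and c: "c > 0" "\<forall>n\<in>\<Delta>. n \<ge> 2 \<longrightarrow> c \<le> r n"
    define E where "E = (\<lambda>n::nat. SUP k\<in>{k. even k \<and> int n \<le> \<bar>k\<bar>}. norm (V k) * \<Omega> k)"
    have nonneg: "0 \<le> norm (V k) * \<Omega> k" if "even k" for k
      using pos[OF that] by simp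
    have E: "norm (V k) * \<Omega> k \<le> E n" if "even k" "int n \<le> \<bar>k\<bar>" for n k
      unfolding E_def using even_tail_SUP(1)[OF nonneg M lim that] .
    have E0: "E \<longlonglongrightarrow> 0"
      unfolding E_def using even_tail_SUP(2)[OF nonneg M lim] .
    have r: "\<forall>\<^sub>F n in to_infinity_in \<Delta>. c \<le> r n"
      unfolding to_infinity_in_def eventually_inf_principal
      using eventually_ge_at_top[of 2] by eventually_elim (use c in auto)
    have quotient: "((\<lambda>n. f n / r n) \<longlongrightarrow> 0) (to_infinity_in \<Delta>)"
      if f: "(f \<longlongrightarrow> 0) (to_infinity_in \<Delta>)" for f
    proof (rule Lim_null_comparison)
      show "\<forall>\<^sub>F n in to_infinity_in \<Delta>. norm (f n / r n) \<le> \<bar>f n\<bar> / c"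
        using r by eventually_elim (use c(1) in \<open>auto simp: intro!: divide_left_mono\<close>)
      show "((\<lambda>n. \<bar>f n\<bar> / c) \<longlongrightarrow> 0) (to_infinity_in \<Delta>)"
        using tendsto_divide[OF tendsto_rabs[OF f] tendsto_const[of c]] c(1) by simp
    qed
    show ?thesis
    proof (rule *[where \<epsilon> = E])
      show "\<forall>\<^sub>F n in to_infinity_in \<Delta>. 0 < r n"
        using r by eventually_elim (use c(1) in auto)
      show "((\<lambda>n. E n / r n) \<longlongrightarrow> 0) (to_infinity_in \<Delta>)"
        by (rule quotient[OF tendsto_mono[OF to_infinity_in_le E0]])
      show "((\<lambda>n. ln (real n) / real n / r n) \<longlongrightarrow> 0) (to_infinity_in \<Delta>)"
        by (rule quotient[OF ln0])
    qed (use E in auto)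
  qed
qed

theorem theorem13:
  fixes \<Omega> :: "int \<Rightarrow> real"
    and v :: "(real \<Rightarrow> complex) \<Rightarrow> complex"
    and V :: "int \<Rightarrow> complex"
  assumes "weight \<Omega>"
    and "almost_submultiplicative \<Omega>"
    and "v \<in> W_infty \<Omega>"
    and "\<forall>k. even k \<longrightarrow> V k = fourier_coeff v k"
  shows
    "(\<forall>\<Delta> :: nat set. infinite \<Delta> \<longrightarrow>
        filterlim (\<lambda>n. norm (V (2 * int n)) * (real n / ln (real n)) * \<Omega> (2 * int n))
          at_top (to_infinity_in \<Delta>) \<longrightarrow>
        filterlim (\<lambda>n. norm (V (- 2 * int n)) * (real n / ln (real n)) * \<Omega> (2 * int n))
          at_top (to_infinity_in \<Delta>) \<longrightarrow>
        sim_on_discs (beta_plus v) (\<lambda>n. V (2 * int n)) \<Delta> \<and>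
        sim_on_discs (beta_minus v) (\<lambda>n. V (- 2 * int n)) \<Delta>)
     \<and>
     (((\<lambda>k. norm (V k) * \<Omega> k) \<longlongrightarrow> 0)
          (inf (filtercomap (\<lambda>k. \<bar>k\<bar>) at_top) (principal {k. even k})) \<longrightarrow>
      (\<forall>\<Delta> :: nat set. infinite \<Delta> \<longrightarrow>
        (\<exists>c>0. \<forall>n\<in>\<Delta>. n \<ge> 2 \<longrightarrow>
           norm (V (2 * int n)) * (real n / ln (real n)) * \<Omega> (2 * int n) \<ge> c \<and>
           norm (V (- 2 * int n)) * (real n / ln (real n)) * \<Omega> (2 * int n) \<ge> c) \<longrightarrow>
        sim_on_discs (beta_plus v) (\<lambda>n. V (2 * int n)) \<Delta> \<and>
        sim_on_discs (beta_minus v) (\<lambda>n. V (- 2 * int n)) \<Delta>))"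
proof -
  let ?W = "fourier_coeff v"
  let ?null = "\<lambda>U :: int \<Rightarrow> complex. ((\<lambda>k. norm (U k) * \<Omega> k) \<longlongrightarrow> 0)
          (inf (filtercomap (\<lambda>k. \<bar>k\<bar>) at_top) (principal {k. even k}))"
  have pos: "\<And>k. even k \<Longrightarrow> \<Omega> k > 0" and sym: "\<And>n. \<Omega> (- 2 * int n) = \<Omega> (2 * int n)"
    using assms(1) by (auto simp: weight_def)
  obtain M where M: "\<And>k. even k \<Longrightarrow> norm (?W k) * \<Omega> k \<le> M"
    using W_infty_bounded[OF assms(3)] by blast
  have V: "V (2 * int n) = ?W (2 * int n)" "V (- 2 * int n) = ?W (- 2 * int n)" for n
    using assms(4) by auto
  have null: "?null V \<longleftrightarrow> ?null ?W"
    by (rule tendsto_cong) (use assms(4) in \<open>auto simp: eventually_inf_principal\<close>)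
  have minus: "sim_on_discs (beta_minus v) (\<lambda>n. V (- 2 * int n)) \<Delta>"
    if "filterlim (\<lambda>n. norm (V (- 2 * int n)) * (real n / ln (real n)) * \<Omega> (2 * int n))
          at_top (to_infinity_in \<Delta>) \<or>
        ?null V \<and> (\<exists>c>0. \<forall>n\<in>\<Delta>. n \<ge> 2 \<longrightarrow>
          c \<le> norm (V (- 2 * int n)) * (real n / ln (real n)) * \<Omega> (2 * int n))" for \<Delta>
    using sim_on_discs_of_weighted_size[where V = ?W and a = int and \<Delta> = \<Delta>, OF pos assms(2) M] that
    unfolding beta_minus_eq_chain_series V sym null by simp
  have plus: "sim_on_discs (beta_plus v) (\<lambda>n. V (2 * int n)) \<Delta>"
    if "filterlim (\<lambda>n. norm (V (2 * int n)) * (real n / ln (real n)) * \<Omega> (2 * int n))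
          at_top (to_infinity_in \<Delta>) \<or>
        ?null V \<and> (\<exists>c>0. \<forall>n\<in>\<Delta>. n \<ge> 2 \<longrightarrow>
          c \<le> norm (V (2 * int n)) * (real n / ln (real n)) * \<Omega> (2 * int n))" for \<Delta>
    using sim_on_discs_of_weighted_size[where V = ?W and a = "\<lambda>n. - int n" and \<Delta> = \<Delta>, OF pos assms(2) M] that
    unfolding beta_plus_eq_chain_series V null by simp
  show ?thesis
    using plus minus by blast
qed

end
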